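(* Let $m\ge 1$ be an integer and let $(A_k)_{1\le k\le N}$ be a finite sequence of $m$-dependent events on a probability space with probability measure $\mathbb{P}$. Then $$\mathbb{P}\Bigl(\bigcup_{k=1}^N A_k\Bigr)\ \ge\ 1-\exp\Biggl(-\frac{1}{2}\sum_{k=1}^N\mathbb{P}(A_k)+\frac{1}{2}\sum_{\substack{1\le i<j\le N\\ |i-j|\le m-1}}\mathbb{P}(A_i\cap A_j)\Biggr).$$
   Context: For finite index sets $I,J\subseteq\mathbb{N}$, put $\mathrm{dist}(I,J)=\inf\{|i-j| : i\in I,\ j\in J\}$. A sequence of events $(A_k)$ on a probability space is called $m$-dependent if, whenever $I,J$ are finite sets of indices of the sequence with $\mathrm{dist}(I,J)>m$, the sigma-algebras generated by $\{A_i : i\in I\}$ and by $\{A_j : j\in J\}$ are independent. For a finite sequence $(A_k)_{1\le k\le N}$, the index sets $I,J$ range over subsets of $\{1,\dots,N\}$. *)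

theory Defs
  imports "HOL-Probability.Probability"
begin

text \<open>The distance takes values in \<open>enat\<close>, so that the infimum over the empty set is \<open>\<infinity>\<close>.\<close>

definition index_dist :: "nat set \<Rightarrow> nat set \<Rightarrow> enat" where
  "index_dist I J = (INF (i, j)\<in>I \<times> J. enat (nat \<bar>int i - int j\<bar>))"

definition (in prob_space) m_dependent_events :: "nat \<Rightarrow> (nat \<Rightarrow> 'a set) \<Rightarrow> nat set \<Rightarrow> bool" where
  "m_dependent_events m A K \<longleftrightarrow>
     (\<forall>k\<in>K. A k \<in> events) \<and>
     (\<forall>I J. finite I \<longrightarrow> finite J \<longrightarrow> I \<subseteq> K \<longrightarrow> J \<subseteq> K \<longrightarrow> index_dist I J > enat m \<longrightarrow>
        indep_set (sigma_sets (space M) (A ` I)) (sigma_sets (space M) (A ` J)))"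

end

theory Submission
  imports Defs
begin

text \<open>Cut \<open>{1..N}\<close> into consecutive blocks of length \<open>m\<close>. Two blocks that are not adjacent are
  separated by a whole block, hence more than \<open>m\<close> apart, so the unions
  \<open>U\<^sub>l = (\<Union>k \<in> l-th block. A k)\<close> over the even-numbered blocks are independent, and
  so are those over the odd-numbered blocks. Therefore the probability that no \<open>A k\<close> occurs is at
  most \<open>\<Prod>(1 - \<P>(U\<^sub>l)) \<le> exp (- \<Sum> \<P>(U\<^sub>l))\<close>, where \<open>l\<close> runs over
  the even numbers or over the odd numbers, at choice
  (\<open>prob_avoid_separated_blocks_le\<close>). The better of the two bounds is at most their geometric
  mean, which is where the factor \<open>1/2\<close> comes from. Finally \<open>\<P>(U\<^sub>l)\<close> is bounded below by the
  Bonferroni inequality (\<open>Bonferroni_lower\<close>); the pairs that it subtracts lie in a common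
  block and so have distance at most \<open>m - 1\<close>.\<close>

lemma index_dist_gtI:
  assumes "\<And>i j. i \<in> I \<Longrightarrow> j \<in> J \<Longrightarrow> i + m < j \<or> j + m < i"
  shows "enat m < index_dist I J"
proof -
  have "enat (Suc m) \<le> index_dist I J"
    unfolding index_dist_def
  proof (rule INF_greatest, clarify)
    fix i j assume "i \<in> I" "j \<in> J"
    then have "Suc m \<le> nat \<bar>int i - int j\<bar>" using assms[of i j] by auto
    then show "enat (Suc m) \<le> enat (nat \<bar>int i - int j\<bar>)" by simp
  qed
  then show ?thesis by (metis Suc_ile_eq)
qed

text \<open>The intersection with \<open>{1..N}\<close> truncates the last block, as \<open>m\<close> need not divide \<open>N\<close>.\<close>

definition block :: "nat \<Rightarrow> nat \<Rightarrow> nat \<Rightarrow> nat set" where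
  "block m N l = {m * l<..m * l + m} \<inter> {1..N}"

definition ordered_pairs :: "nat set \<Rightarrow> (nat \<times> nat) set" where
  "ordered_pairs F = {(i, j). i \<in> F \<and> j \<in> F \<and> i < j}"

lemma finite_block [simp]: "finite (block m N l)"
  by (simp add: block_def)

lemma block_subset: "block m N l \<subseteq> {1..N}"
  by (simp add: block_def)

lemma finite_ordered_pairs: "finite F \<Longrightarrow> finite (ordered_pairs F)"
  by (rule finite_subset[of _ "F \<times> F"]) (auto simp: ordered_pairs_def)

lemma block_separated:
  assumes "l + 2 \<le> l'" "i \<in> block m N l" "j \<in> block m N l'"
  shows "i + m < j"
proof -
  have "m * (l + 2) \<le> m * l'" using assms(1) by (rule mult_le_mono2)
  then show ?thesis using assms(2,3) by (auto simp: block_def algebra_simps)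
qed

lemma block_disjoint:
  assumes "l \<noteq> l'"
  shows "block m N l \<inter> block m N l' = {}"
proof -
  have *: "block m N a \<inter> block m N b = {}" if "a < b" for a b
  proof -
    have "m * (a + 1) \<le> m * b" using that by (intro mult_le_mono2) simp
    then show ?thesis by (auto simp: block_def algebra_simps)
  qed
  show ?thesis
    using assms *[of l l'] *[of l' l] by (cases "l < l'") auto
qed

lemma UN_block:
  assumes "m \<ge> 1"
  shows "(\<Union>l\<in>{..N}. block m N l) = {1..N}"
proof (intro equalityI subsetI)
  fix k assume k: "k \<in> {1..N}"
  define l where "l = (k - 1) div m"
  have "m * l + (k - 1) mod m = k - 1" by (simp add: l_def)
  moreover have "(k - 1) mod m < m" using assms by simp
  ultimately have "k \<in> block m N l" using k by (auto simp: block_def)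
  moreover have "l \<le> k - 1" unfolding l_def by (rule div_le_dividend)
  then have "l \<le> N" using k by auto
  ultimately show "k \<in> (\<Union>l\<in>{..N}. block m N l)" by auto
qed (use block_subset in blast)

context prob_space
begin

text \<open>When the largest index \<open>b\<close> is added, the probability of the union grows by
  \<open>\<P>(A b)\<close> minus the probability of the overlap of \<open>A b\<close> with the earlier events, and
  the overlap is controlled by the union bound.\<close>

lemma Bonferroni_lower:
  assumes "finite (F :: nat set)" "\<And>k. k \<in> F \<Longrightarrow> A k \<in> events"
  shows "(\<Sum>k\<in>F. prob (A k)) - (\<Sum>(i, j)\<in>ordered_pairs F. prob (A i \<inter> A j))
           \<le> prob (\<Union>k\<in>F. A k)"
  using assms
proof (induction F rule: finite_linorder_max_induct)
  case empty
  then show ?case by (simp add: ordered_pairs_def)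
next
  case (insert b F)
  let ?U = "\<Union>k\<in>F. A k" and ?p = "\<lambda>(i, j). prob (A i \<inter> A j)"
  have b: "A b \<in> events" and F: "\<And>k. k \<in> F \<Longrightarrow> A k \<in> events"
    using insert.prems by auto
  then have U: "?U \<in> events" using insert.hyps(1) by auto
  have nb: "b \<notin> F" using insert.hyps by auto
  have split: "ordered_pairs (insert b F) = ordered_pairs F \<union> (\<lambda>i. (i, b)) ` F"
    using insert.hyps(2) by (auto simp: ordered_pairs_def dest: less_asym)
  have "sum ?p (ordered_pairs (insert b F)) = sum ?p (ordered_pairs F) + sum ?p ((\<lambda>i. (i, b)) ` F)"
    unfolding split using insert.hyps(1) nb
    by (intro sum.union_disjoint finite_ordered_pairs) (auto simp: ordered_pairs_def)
  also have "sum ?p ((\<lambda>i. (i, b)) ` F) = (\<Sum>i\<in>F. prob (A i \<inter> A b))"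
    by (subst sum.reindex) (auto simp: inj_on_def)
  finally have pairs: "sum ?p (ordered_pairs (insert b F)) =
      sum ?p (ordered_pairs F) + (\<Sum>i\<in>F. prob (A i \<inter> A b))" .
  have "prob (?U \<inter> A b) = prob (\<Union>i\<in>F. A i \<inter> A b)"
    by (intro arg_cong[where f = prob]) auto
  also have "\<dots> \<le> (\<Sum>i\<in>F. prob (A i \<inter> A b))"
    using insert.hyps(1) F b by (intro finite_measure_subadditive_finite) auto
  finally have overlap: "prob (?U \<inter> A b) \<le> (\<Sum>i\<in>F. prob (A i \<inter> A b))" .
  have "prob (?U \<union> A b) = prob ?U + prob (A b) - prob (?U \<inter> A b)"
    using U b by (intro measure_Un3) (auto simp: fmeasurable_eq_sets)
  moreover have "(\<Union>k\<in>insert b F. A k) = ?U \<union> A b" by auto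
  moreover have "(\<Sum>k\<in>insert b F. prob (A k)) = prob (A b) + (\<Sum>k\<in>F. prob (A k))"
    using insert.hyps(1) nb by simp
  ultimately show ?case using insert.IH[OF F] pairs overlap by simp
qed

lemma m_dependent_avoid_mult:
  assumes "m_dependent_events m A K" "finite I" "finite J" "I \<subseteq> K" "J \<subseteq> K"
    and "enat m < index_dist I J"
  shows "prob (space M - (\<Union>k\<in>I \<union> J. A k)) =
    prob (space M - (\<Union>k\<in>I. A k)) * prob (space M - (\<Union>k\<in>J. A k))"
proof -
  have mem: "space M - (\<Union>k\<in>F. A k) \<in> sigma_sets (space M) (A ` F)" if "finite F" for F
    using that
    by (intro sigma_sets.Compl sigma_sets_UNION) (auto intro: countable_finite)
  have "indep_set (sigma_sets (space M) (A ` I)) (sigma_sets (space M) (A ` J))"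
    using assms unfolding m_dependent_events_def by blast
  from indep_setD[OF this mem[OF assms(2)] mem[OF assms(3)]]
  show ?thesis
    by (simp add: Diff_Un)
qed

text \<open>By induction on the set of blocks: the block that is added lies at distance more than
  \<open>m\<close> from all the others, so its avoidance probability \<open>1 - x \<le> exp (- x)\<close> splits off
  as a factor.\<close>

lemma prob_avoid_separated_blocks_le:
  assumes "m_dependent_events m A {1..N}" "finite L"
    and "\<And>l l'. l \<in> L \<Longrightarrow> l' \<in> L \<Longrightarrow> l < l' \<Longrightarrow> l + 2 \<le> l'"
  shows "prob (space M - (\<Union>k\<in>(\<Union>l\<in>L. block m N l). A k))
    \<le> exp (- (\<Sum>l\<in>L. prob (\<Union>k\<in>block m N l. A k)))"
  using assms(2,3)
proof (induction L rule: finite_induct)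
  case empty
  then show ?case by simp
next
  case (insert n L)
  let ?I = "\<Union>l\<in>L. block m N l" and ?J = "block m N n"
  let ?x = "prob (\<Union>k\<in>?J. A k)"
  have "enat m < index_dist ?I ?J"
  proof (rule index_dist_gtI)
    fix i j assume "i \<in> ?I" and j: "j \<in> ?J"
    then obtain l where l: "l \<in> L" "i \<in> block m N l" by blast
    then have "l \<noteq> n" using insert.hyps(2) by auto
    then have "l + 2 \<le> n \<or> n + 2 \<le> l"
      using insert.prems[of l n] insert.prems[of n l] l(1) by (auto simp: neq_iff)
    then show "i + m < j \<or> j + m < i"
      using block_separated l(2) j by blast
  qed
  then have "prob (space M - (\<Union>k\<in>?I \<union> ?J. A k)) =
    prob (space M - (\<Union>k\<in>?I. A k)) * prob (space M - (\<Union>k\<in>?J. A k))"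
    using insert.hyps(1) block_subset
    by (intro m_dependent_avoid_mult[OF assms(1)]) (auto simp: subset_iff)
  also have "\<dots> \<le> exp (- (\<Sum>l\<in>L. prob (\<Union>k\<in>block m N l. A k))) * exp (- ?x)"
  proof (rule mult_mono)
    show "prob (space M - (\<Union>k\<in>?I. A k)) \<le> exp (- (\<Sum>l\<in>L. prob (\<Union>k\<in>block m N l. A k)))"
      using insert.prems by (intro insert.IH) auto
    have "A k \<in> events" if "k \<in> ?J" for k
      using assms(1) subsetD[OF block_subset that] unfolding m_dependent_events_def by simp
    then have "(\<Union>k\<in>?J. A k) \<in> events" by auto
    then have "prob (space M - (\<Union>k\<in>?J. A k)) = 1 - ?x" by (rule prob_compl)
    also have "\<dots> \<le> exp (- ?x)" using exp_ge_add_one_self[of "- ?x"] by simp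
    finally show "prob (space M - (\<Union>k\<in>?J. A k)) \<le> exp (- ?x)" .
  qed auto
  also have "\<dots> = exp (- (\<Sum>l\<in>insert n L. prob (\<Union>k\<in>block m N l. A k)))"
    using insert.hyps by (simp add: exp_add[symmetric])
  finally show ?case by (simp add: Un_commute)
qed

end

theorem theorem4:
  fixes M :: "'a measure" and A :: "nat \<Rightarrow> 'a set" and m N :: nat
  assumes "prob_space M"
    and "m \<ge> 1"
    and "prob_space.m_dependent_events M m A {1..N}"
  shows "measure M (\<Union>k\<in>{1..N}. A k) \<ge>
    1 - exp (- (1 / 2) * (\<Sum>k = 1..N. measure M (A k))
             + (1 / 2) * (\<Sum>(i, j) \<in> {(i, j). 1 \<le> i \<and> i < j \<and> j \<le> N \<and> \<bar>int i - int j\<bar> \<le> int m - 1}.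
                            measure M (A i \<inter> A j)))"
proof -
  interpret prob_space M by fact
  note dep = assms(3)
  have ev: "A k \<in> events" if "k \<in> {1..N}" for k
    using dep that unfolding m_dependent_events_def by blast
  let ?D = "{(i, j). 1 \<le> i \<and> i < j \<and> j \<le> N \<and> \<bar>int i - int j\<bar> \<le> int m - 1}"
  let ?p = "\<lambda>(i, j). prob (A i \<inter> A j)"
  let ?u = "\<lambda>l. prob (\<Union>k\<in>block m N l. A k)"
  let ?U = "\<Union>k\<in>{1..N}. A k"
  define Ev where "Ev = {l \<in> {..N}. even l}"
  define Od where "Od = {l \<in> {..N}. odd l}"

  have avoid: "1 - prob ?U \<le> exp (- sum ?u L)"
    if L: "L \<subseteq> {..N}" "\<And>l l'. l \<in> L \<Longrightarrow> l' \<in> L \<Longrightarrow> even l \<longleftrightarrow> even l'" for L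
  proof -
    have fin: "finite L" using L(1) finite_subset by blast
    have sub: "(\<Union>l\<in>L. block m N l) \<subseteq> {1..N}" using block_subset by blast
    have "1 - prob ?U = prob (space M - ?U)"
      using ev by (intro prob_compl[symmetric]) auto
    also have "\<dots> \<le> prob (space M - (\<Union>k\<in>(\<Union>l\<in>L. block m N l). A k))"
      using sub ev fin by (intro finite_measure_mono sets.Diff sets.finite_UN) auto
    also have "\<dots> \<le> exp (- sum ?u L)"
    proof (rule prob_avoid_separated_blocks_le[OF dep fin])
      fix l l' assume "l \<in> L" "l' \<in> L" "l < l'"
      then show "l + 2 \<le> l'" using L(2)[of l l'] by presburger
    qed
    finally show ?thesis .
  qed
  have parity: "sum ?u {..N} = sum ?u Ev + sum ?u Od"
    by (subst sum.union_disjoint[symmetric])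
       (auto simp: Ev_def Od_def intro!: arg_cong[where f = "sum ?u"])
  have "1 - prob ?U \<le> exp (- sum ?u Ev)" "1 - prob ?U \<le> exp (- sum ?u Od)"
    by (rule avoid; force simp: Ev_def Od_def)+
  then have "1 - prob ?U \<le> exp (- max (sum ?u Ev) (sum ?u Od))"
    by (simp add: max_def)
  \<comment> \<open>The maximum of two numbers is at least their mean.\<close>
  also have "\<dots> \<le> exp (- (1 / 2) * sum ?u {..N})"
    unfolding parity by simp
  finally have half: "1 - prob ?U \<le> exp (- (1 / 2) * sum ?u {..N})" .

  have "(\<Sum>k=1..N. prob (A k)) = (\<Sum>l\<le>N. \<Sum>k\<in>block m N l. prob (A k))"
    unfolding UN_block[OF assms(2), symmetric]
    by (intro sum.UNION_disjoint) (auto simp: block_disjoint)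
  moreover have "(\<Sum>l\<le>N. sum ?p (ordered_pairs (block m N l))) \<le> sum ?p ?D"
  proof -
    have "(\<Sum>l\<le>N. sum ?p (ordered_pairs (block m N l)))
        = sum ?p (\<Union>l\<in>{..N}. ordered_pairs (block m N l))"
    proof (intro sum.UNION_disjoint[symmetric] ballI impI)
      fix l l' :: nat assume "l \<noteq> l'"
      from block_disjoint[OF this, of m N]
      show "ordered_pairs (block m N l) \<inter> ordered_pairs (block m N l') = {}"
        by (auto simp: ordered_pairs_def)
    qed (auto intro: finite_ordered_pairs)
    also have "\<dots> \<le> sum ?p ?D"
    proof (rule sum_mono2)
      show "finite ?D" by (rule finite_subset[of _ "{..N} \<times> {..N}"]) auto
      show "(\<Union>l\<in>{..N}. ordered_pairs (block m N l)) \<subseteq> ?D"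
        by (auto simp: ordered_pairs_def block_def)
    qed auto
    finally show ?thesis .
  qed
  moreover have "(\<Sum>l\<le>N. (\<Sum>k\<in>block m N l. prob (A k)) - sum ?p (ordered_pairs (block m N l)))
      \<le> sum ?u {..N}"
  proof (rule sum_mono)
    fix l
    show "(\<Sum>k\<in>block m N l. prob (A k)) - sum ?p (ordered_pairs (block m N l)) \<le> ?u l"
      using ev block_subset by (intro Bonferroni_lower) (simp, blast)
  qed
  ultimately have "(\<Sum>k=1..N. prob (A k)) - sum ?p ?D \<le> sum ?u {..N}"
    by (simp add: sum_subtractf)
  then have "exp (- (1 / 2) * sum ?u {..N})
      \<le> exp (- (1 / 2) * (\<Sum>k=1..N. prob (A k)) + (1 / 2) * sum ?p ?D)"
    by simp
  with half show ?thesis by linarith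
qed

end
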